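(* Let $\mathfrak h$ be the three-dimensional Heisenberg Lie algebra over $\mathbb C$ with basis $\{e_1,e_2,e_3\}$ and nonzero bracket $[e_1,e_2]=e_3$. Consider the following GD algebra structures on $\mathfrak h$ (products not displayed are zero; parameters are arbitrary complex numbers unless restricted): - $G1_\alpha$: $e_1\circ e_2=e_2+\alpha e_3$, $e_1\circ e_3=e_3$. - $G2_\alpha$: $e_1\circ e_1=e_3$, $e_1\circ e_2=e_1$, $e_2\circ e_1=e_1+\alpha e_3$, $e_2\circ e_2=e_2$, $e_2\circ e_3=e_3$, $e_3\circ e_2=e_3$. - $G3_{\alpha,\beta}$ ($\alpha\ne0$): $e_1\circ e_1=e_1$, $e_1\circ e_2=\alpha e_2+\beta e_3$, $e_1\circ e_3=\alpha e_3$, $e_2\circ e_1=e_2$, $e_3\circ e_1=e_3$. - $G4_\alpha$: $e_1\circ e_1=e_1+e_2$, $e_1\circ e_2=\alpha e_3$, $e_2\circ e_1=e_2$, $e_3\circ e_1=e_3$. - $G5$: $e_1\circ e_1=e_1+e_3$, $e_2\circ e_1=e_2$, $e_3\circ e_1=e_3$. - $G6_\alpha$: $e_1\circ e_2=-\alpha e_3$, $e_2\circ e_1=\alpha e_3$. - $G7$: $e_1\circ e_1=e_1$, $e_1\circ e_2=-e_2$, $e_2\circ e_1=e_2$. - $G8_{\alpha,\beta}$: $e_1\circ e_2=\alpha e_3$, $e_2\circ e_1=\beta e_3$, $e_2\circ e_2=e_1$. - $G9$: $e_2\circ e_2=e_2+e_3$, $e_3\circ e_2=e_3$. - $G10$: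 $e_2\circ e_2=e_2$, $e_3\circ e_2=e_3$. - $G11_{\alpha,\beta}$: $e_1\circ e_1=\alpha e_3$, $e_1\circ e_2=\beta e_3$, $e_2\circ e_2=e_3$. - $G12_\alpha$: $e_1\circ e_1=e_1$, $e_1\circ e_2=\alpha e_3$, $e_2\circ e_1=e_2$, $e_3\circ e_1=e_3$. Among these, the non-special ones are precisely $G7$, $G9$, $G10$. All the remaining cases $G1_\alpha$, $G2_\alpha$, $G3_{\alpha,\beta}$ ($\alpha\ne0$), $G4_\alpha$, $G5$, $G6_\alpha$, $G8_{\alpha,\beta}$, $G11_{\alpha,\beta}$, $G12_\alpha$ are special.
   Context: A Novikov algebra is a vector space with a bilinear product $\circ$ satisfying $(x\circ y)\circ z-x\circ(y\circ z)=(y\circ x)\circ z-y\circ(x\circ z)$ and $(x\circ y)\circ z=(x\circ z)\circ y$. A Gelfand--Dorfman (GD) algebra is a triple $(A,\circ,[\cdot,\cdot])$ such that $(A,\circ)$ is a Novikov algebra, $(A,[\cdot,\cdot])$ is a Lie algebra, and for all $x,y,z\in A$: $[x,y\circ z]-[z,y\circ x]+[y,x]\circ z-[y,z]\circ x-y\circ[x,z]=0$. A differential Poisson algebra $(P,\cdot,\{\cdot,\cdot\},d)$ is a Poisson algebra (with commutative associative product $\cdot$; not required to be finite-dimensional) with a linear map $d$ that is a derivation of both $\cdot$ and $\{\cdot,\cdot\}$. It induces a GD algebra $P^{(d)}$ on $P$ by $[u,v]=\{u,v\}$, $u\circ v=u\cdot d(v)$. A GD algebra is special if it is isomorphic to a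 GD subalgebra of $P^{(d)}$ for some differential Poisson algebra $P$. *)

theory Defs
  imports
    "HOL-Analysis.Cartesian_Space"
    "HOL-Computational_Algebra.Formal_Power_Series"
begin

definition bilinear_map ::
  "('k::field \<Rightarrow> 'a::ab_group_add \<Rightarrow> 'a) \<Rightarrow> ('a \<Rightarrow> 'a \<Rightarrow> 'a) \<Rightarrow> bool" where
  "bilinear_map smul f \<longleftrightarrow>
     (\<forall>x. Vector_Spaces.linear smul smul (\<lambda>y. f x y)) \<and>
     (\<forall>y. Vector_Spaces.linear smul smul (\<lambda>x. f x y))"

locale novikov_algebra = vector_space smul
  for smul :: "'k::field \<Rightarrow> 'a::ab_group_add \<Rightarrow> 'a" +
  fixes circ :: "'a \<Rightarrow> 'a \<Rightarrow> 'a"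
  assumes circ_bilinear: "bilinear_map smul circ"
    and left_symmetric:
      "circ (circ x y) z - circ x (circ y z) = circ (circ y x) z - circ y (circ x z)"
    and right_commutative: "circ (circ x y) z = circ (circ x z) y"

locale lie_algebra = vector_space smul
  for smul :: "'k::field \<Rightarrow> 'a::ab_group_add \<Rightarrow> 'a" +
  fixes brk :: "'a \<Rightarrow> 'a \<Rightarrow> 'a"
  assumes brk_bilinear: "bilinear_map smul brk"
    and brk_alternating: "brk x x = 0"
    and jacobi: "brk x (brk y z) + brk y (brk z x) + brk z (brk x y) = 0"

locale gd_algebra = novikov_algebra smul circ + lie_algebra smul brk
  for smul :: "'k::field \<Rightarrow> 'a::ab_group_add \<Rightarrow> 'a"
    and circ :: "'a \<Rightarrow> 'a \<Rightarrow> 'a"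
    and brk :: "'a \<Rightarrow> 'a \<Rightarrow> 'a" +
  assumes gd_compatible:
    "brk x (circ y z) - brk z (circ y x) + circ (brk y x) z - circ (brk y z) x
       - circ y (brk x z) = 0"

text \<open>The commutative product of a Poisson algebra is not required to have a unit.\<close>

locale poisson_algebra = lie_algebra smul brk
  for smul :: "'k::field \<Rightarrow> 'a::ab_group_add \<Rightarrow> 'a"
    and pmult :: "'a \<Rightarrow> 'a \<Rightarrow> 'a"
    and brk :: "'a \<Rightarrow> 'a \<Rightarrow> 'a" +
  assumes mult_bilinear: "bilinear_map smul pmult"
    and mult_commute: "pmult x y = pmult y x"
    and mult_assoc: "pmult (pmult x y) z = pmult x (pmult y z)"
    and leibniz: "brk x (pmult y z) = pmult (brk x y) z + pmult y (brk x z)"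

locale differential_poisson_algebra = poisson_algebra smul pmult brk
  for smul :: "'k::field \<Rightarrow> 'a::ab_group_add \<Rightarrow> 'a"
    and pmult :: "'a \<Rightarrow> 'a \<Rightarrow> 'a"
    and brk :: "'a \<Rightarrow> 'a \<Rightarrow> 'a"
    and d :: "'a \<Rightarrow> 'a" +
  assumes d_linear: "Vector_Spaces.linear smul smul d"
    and d_mult: "d (pmult x y) = pmult (d x) y + pmult x (d y)"
    and d_brk: "d (brk x y) = brk (d x) y + brk x (d y)"

definition induced_circ :: "('a \<Rightarrow> 'a \<Rightarrow> 'a) \<Rightarrow> ('a \<Rightarrow> 'a) \<Rightarrow> 'a \<Rightarrow> 'a \<Rightarrow> 'a" where
  "induced_circ pmult d u v = pmult u (d v)"

definition gd_subalgebra ::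
  "('k::field \<Rightarrow> 'a::ab_group_add \<Rightarrow> 'a) \<Rightarrow> ('a \<Rightarrow> 'a \<Rightarrow> 'a) \<Rightarrow> ('a \<Rightarrow> 'a \<Rightarrow> 'a) \<Rightarrow> 'a set \<Rightarrow> bool" where
  "gd_subalgebra smul circ brk S \<longleftrightarrow>
     module.subspace smul S \<and> (\<forall>x\<in>S. \<forall>y\<in>S. circ x y \<in> S \<and> brk x y \<in> S)"

definition gd_iso_onto ::
  "('k::field \<Rightarrow> 'a::ab_group_add \<Rightarrow> 'a) \<Rightarrow> ('a \<Rightarrow> 'a \<Rightarrow> 'a) \<Rightarrow> ('a \<Rightarrow> 'a \<Rightarrow> 'a) \<Rightarrow>
   ('k \<Rightarrow> 'p::ab_group_add \<Rightarrow> 'p) \<Rightarrow> ('p \<Rightarrow> 'p \<Rightarrow> 'p) \<Rightarrow> ('p \<Rightarrow> 'p \<Rightarrow> 'p) \<Rightarrow> 'p set \<Rightarrow>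
   ('a \<Rightarrow> 'p) \<Rightarrow> bool" where
  "gd_iso_onto smul circ brk smul' circ' brk' S f \<longleftrightarrow>
     Vector_Spaces.linear smul smul' f \<and> bij_betw f UNIV S \<and>
     (\<forall>x y. f (circ x y) = circ' (f x) (f y)) \<and>
     (\<forall>x y. f (brk x y) = brk' (f x) (f y))"

text \<open>
  A formula of HOL cannot quantify over types, so the type carrying the differential Poisson
  algebra is a parameter of specialness. A GD algebra is special iff \<open>special_via\<close> holds for some
  type \<open>'p\<close>, and non-special iff it fails for every type \<open>'p\<close>.
\<close>

definition special_via ::
  "'p::ab_group_add itself \<Rightarrow> ('k::field \<Rightarrow> 'a::ab_group_add \<Rightarrow> 'a) \<Rightarrow>
   ('a \<Rightarrow> 'a \<Rightarrow> 'a) \<Rightarrow> ('a \<Rightarrow> 'a \<Rightarrow> 'a) \<Rightarrow> bool" where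
  "special_via T smul circ brk \<longleftrightarrow>
     (\<exists>(psmul :: 'k \<Rightarrow> 'p \<Rightarrow> 'p) pmult pbrk d S f.
        differential_poisson_algebra psmul pmult pbrk d \<and>
        gd_subalgebra psmul (induced_circ pmult d) pbrk S \<and>
        gd_iso_onto smul circ brk psmul (induced_circ pmult d) pbrk S f)"

abbreviation eb :: "3 \<Rightarrow> complex ^ 3" where
  "eb i \<equiv> axis i 1"

text \<open>The bilinear product on \<open>complex ^ 3\<close> with \<open>t (i, j)\<close> as the product of \<open>eb i\<close> and \<open>eb j\<close>.\<close>

definition product_of_table :: "(3 \<times> 3 \<Rightarrow> complex ^ 3) \<Rightarrow> complex ^ 3 \<Rightarrow> complex ^ 3 \<Rightarrow> complex ^ 3" where
  "product_of_table t x y = (\<Sum>i\<in>UNIV. \<Sum>j\<in>UNIV. (x $ i * y $ j) *s t (i, j))"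

definition heis :: "complex ^ 3 \<Rightarrow> complex ^ 3 \<Rightarrow> complex ^ 3" where
  "heis = product_of_table ((\<lambda>_. 0)((1, 2) := eb 3, (2, 1) := - eb 3))"

definition G1 :: "complex \<Rightarrow> complex ^ 3 \<Rightarrow> complex ^ 3 \<Rightarrow> complex ^ 3" where
  "G1 \<alpha> = product_of_table ((\<lambda>_. 0)((1, 2) := eb 2 + \<alpha> *s eb 3, (1, 3) := eb 3))"

definition G2 :: "complex \<Rightarrow> complex ^ 3 \<Rightarrow> complex ^ 3 \<Rightarrow> complex ^ 3" where
  "G2 \<alpha> = product_of_table ((\<lambda>_. 0)
     ((1, 1) := eb 3, (1, 2) := eb 1, (2, 1) := eb 1 + \<alpha> *s eb 3,
      (2, 2) := eb 2, (2, 3) := eb 3, (3, 2) := eb 3))"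

definition G3 :: "complex \<Rightarrow> complex \<Rightarrow> complex ^ 3 \<Rightarrow> complex ^ 3 \<Rightarrow> complex ^ 3" where
  "G3 \<alpha> \<beta> = product_of_table ((\<lambda>_. 0)
     ((1, 1) := eb 1, (1, 2) := \<alpha> *s eb 2 + \<beta> *s eb 3, (1, 3) := \<alpha> *s eb 3,
      (2, 1) := eb 2, (3, 1) := eb 3))"

definition G4 :: "complex \<Rightarrow> complex ^ 3 \<Rightarrow> complex ^ 3 \<Rightarrow> complex ^ 3" where
  "G4 \<alpha> = product_of_table ((\<lambda>_. 0)
     ((1, 1) := eb 1 + eb 2, (1, 2) := \<alpha> *s eb 3, (2, 1) := eb 2, (3, 1) := eb 3))"

definition G5 :: "complex ^ 3 \<Rightarrow> complex ^ 3 \<Rightarrow> complex ^ 3" where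
  "G5 = product_of_table ((\<lambda>_. 0)
     ((1, 1) := eb 1 + eb 3, (2, 1) := eb 2, (3, 1) := eb 3))"

definition G6 :: "complex \<Rightarrow> complex ^ 3 \<Rightarrow> complex ^ 3 \<Rightarrow> complex ^ 3" where
  "G6 \<alpha> = product_of_table ((\<lambda>_. 0)((1, 2) := - \<alpha> *s eb 3, (2, 1) := \<alpha> *s eb 3))"

definition G7 :: "complex ^ 3 \<Rightarrow> complex ^ 3 \<Rightarrow> complex ^ 3" where
  "G7 = product_of_table ((\<lambda>_. 0)((1, 1) := eb 1, (1, 2) := - eb 2, (2, 1) := eb 2))"

definition G8 :: "complex \<Rightarrow> complex \<Rightarrow> complex ^ 3 \<Rightarrow> complex ^ 3 \<Rightarrow> complex ^ 3" where
  "G8 \<alpha> \<beta> = product_of_table ((\<lambda>_. 0)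
     ((1, 2) := \<alpha> *s eb 3, (2, 1) := \<beta> *s eb 3, (2, 2) := eb 1))"

definition G9 :: "complex ^ 3 \<Rightarrow> complex ^ 3 \<Rightarrow> complex ^ 3" where
  "G9 = product_of_table ((\<lambda>_. 0)((2, 2) := eb 2 + eb 3, (3, 2) := eb 3))"

definition G10 :: "complex ^ 3 \<Rightarrow> complex ^ 3 \<Rightarrow> complex ^ 3" where
  "G10 = product_of_table ((\<lambda>_. 0)((2, 2) := eb 2, (3, 2) := eb 3))"

definition G11 :: "complex \<Rightarrow> complex \<Rightarrow> complex ^ 3 \<Rightarrow> complex ^ 3 \<Rightarrow> complex ^ 3" where
  "G11 \<alpha> \<beta> = product_of_table ((\<lambda>_. 0)
     ((1, 1) := \<alpha> *s eb 3, (1, 2) := \<beta> *s eb 3, (2, 2) := eb 3))"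

definition G12 :: "complex \<Rightarrow> complex ^ 3 \<Rightarrow> complex ^ 3 \<Rightarrow> complex ^ 3" where
  "G12 \<alpha> = product_of_table ((\<lambda>_. 0)
     ((1, 1) := eb 1, (1, 2) := \<alpha> *s eb 3, (2, 1) := eb 2, (3, 1) := eb 3))"

abbreviation heis_gd :: "(complex ^ 3 \<Rightarrow> complex ^ 3 \<Rightarrow> complex ^ 3) \<Rightarrow> bool" where
  "heis_gd circ \<equiv> gd_algebra (*s) circ heis"

text \<open>
  A concrete type for the positive results. Its additive group has infinite dimension over the
  complex numbers, and \<open>special_via\<close> leaves the scalar action and the remaining operations free. So
  nothing is lost for a finite-dimensional GD algebra: its image generates a differential Poisson
  algebra of countable dimension, and a direct summand with zero operations can be added.
\<close>

abbreviation heis_special :: "(complex ^ 3 \<Rightarrow> complex ^ 3 \<Rightarrow> complex ^ 3) \<Rightarrow> bool" where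
  "heis_special circ \<equiv> special_via TYPE(complex fps fps) (*s) circ heis"

end

theory Submission
  imports Defs
begin

text \<open>
  \<^emph>\<open>Non-special cases.\<close> Write \<open>a, b, c\<close> for the images of the basis vectors in a differential
  Poisson algebra, so that \<open>c = {a, b}\<close>, and use the Leibniz rule on products that the table
  prescribes.

  \<^item> For \<open>G7\<close> put \<open>w = {a, d a}\<close>. Bracketing \<open>a = a (d a)\<close> with \<open>a\<close> gives \<open>a w = 0\<close>, and
    bracketing \<open>b = b (d a)\<close> with \<open>a\<close> gives \<open>b w = c\<close> because \<open>c (d a) = 0\<close>. As \<open>b = - a (d b)\<close> is a multiple of \<open>a\<close>, also
    \<open>c = 0\<close>.
  \<^item> For \<open>G9\<close> and \<open>G10\<close> put \<open>w = {b, d b}\<close>. Bracketing \<open>a (d b) = 0\<close> with \<open>b\<close> gives \<open>c = a w\<close>, hence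
    \<open>c = c (d b) = a (d b) w = 0\<close>.

  \<^emph>\<open>Special cases.\<close> It is enough to give a differential Poisson algebra and three linearly
  independent elements \<open>a, b, c\<close> whose products \<open>u (d v)\<close> and brackets follow the table
  (\<open>special_via_table\<close>). Three families of algebras suffice.

  \<^item> \<open>G1\<close>--\<open>G5\<close> and \<open>G12\<close> contain relations of the type \<open>u (d v) = v + \<dots>\<close>, which call for units
    and for elements such as \<open>x\<close> with \<open>x (d x) = x\<close>. They embed into the free module with basis
    \<open>1, y, z\<close> over the power series in one variable \<open>t\<close>, with \<open>{t, y} = z\<close> and a derivation that is
    either zero or \<open>d/dt\<close> on series (\<open>differential_poisson_ext\<close>). The tables become first order differential equations, solved in terms of \<open>x = 1 + t\<close> and \<open>log x\<close>.
  \<^item> In \<open>G6\<close> and \<open>G11\<close> the product takes values in the centre, spanned by \<open>e3\<close>, and \<open>e3\<close>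
    multiplies to zero. For such a product one adjoins formal derivatives of \<open>e1, e2\<close> and a formal
    primitive of \<open>e3\<close> (\<open>differential_poisson_two_step\<close>).
  \<^item> \<open>G8\<close> is generated by \<open>e2 = b\<close>, with \<open>e1 = b (d b)\<close> and \<open>e3 = {b (d b), b}\<close>. It lies in an algebra
    graded by the degree in \<open>b\<close> and truncated above degree three
    (\<open>differential_poisson_G8\<close>).

  The Gelfand--Dorfman axioms are polynomial identities in the coordinates.
\<close>

section \<open>The Gelfand--Dorfman axioms\<close>

lemma bilinear_map_product_of_table: "bilinear_map (*s) (product_of_table t)"
proof -
  have "product_of_table t x (y + z) = product_of_table t x y + product_of_table t x z"
    and "product_of_table t (x + z) y = product_of_table t x y + product_of_table t z y"
    and "product_of_table t x (c *s y) = c *s product_of_table t x y"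
    and "product_of_table t (c *s x) y = c *s product_of_table t x y" for x y z c
    unfolding product_of_table_def
    by (simp_all add: sum.distrib vec.scale_sum_right algebra_simps)
  then show ?thesis
    unfolding bilinear_map_def Vector_Spaces.linear_iff
    by (simp add: vec.vector_space_axioms)
qed

lemma product_of_table_3:
  "product_of_table t x y =
     (x $ 1 * y $ 1) *s t (1, 1) + (x $ 1 * y $ 2) *s t (1, 2) + (x $ 1 * y $ 3) *s t (1, 3) +
     (x $ 2 * y $ 1) *s t (2, 1) + (x $ 2 * y $ 2) *s t (2, 2) + (x $ 2 * y $ 3) *s t (2, 3) +
     (x $ 3 * y $ 1) *s t (3, 1) + (x $ 3 * y $ 2) *s t (3, 2) + (x $ 3 * y $ 3) *s t (3, 3)"
  by (simp add: product_of_table_def sum_3 add.assoc)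

lemma heis_component [simp]:
  "heis x y $ 1 = 0" "heis x y $ 2 = 0" "heis x y $ 3 = x $ 1 * y $ 2 - x $ 2 * y $ 1"
  by (simp_all add: heis_def product_of_table_3 axis_def)

lemma heis_gd_product_of_table:
  fixes t defines "circ \<equiv> product_of_table t"
  assumes "\<And>x y z. circ (circ x y) z - circ x (circ y z) = circ (circ y x) z - circ y (circ x z)"
    and "\<And>x y z. circ (circ x y) z = circ (circ x z) y"
    and "\<And>x y z. heis x (circ y z) - heis z (circ y x) + circ (heis y x) z - circ (heis y z) x
       - circ y (heis x z) = 0"
  shows "heis_gd circ"
proof unfold_locales
  show "bilinear_map (*s) circ" "bilinear_map (*s) heis"
    unfolding circ_def heis_def by (rule bilinear_map_product_of_table)+
  show "heis x x = 0" "heis x (heis y z) + heis y (heis z x) + heis z (heis x y) = 0" for x y z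
    by (simp_all add: vec_eq_iff forall_3)
qed (use assms in auto)

lemma heis_gd_G1_to_G12:
  "heis_gd (G1 \<alpha>)" "heis_gd (G2 \<alpha>)" "heis_gd (G3 \<alpha> \<beta>)" "heis_gd (G4 \<alpha>)" "heis_gd (G5)" "heis_gd (G6 \<alpha>)"
  "heis_gd (G7)" "heis_gd (G8 \<alpha> \<beta>)" "heis_gd (G9)" "heis_gd (G10)" "heis_gd (G11 \<alpha> \<beta>)" "heis_gd (G12 \<alpha>)"
  unfolding G1_def G2_def G3_def G4_def G5_def G6_def G7_def G8_def G9_def G10_def G11_def G12_def
  by (rule heis_gd_product_of_table; simp add: product_of_table_3 vec_eq_iff forall_3 axis_def;
      simp add: algebra_simps)+

section \<open>Brackets that must vanish in a Poisson algebra\<close>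

lemma linear_0: "Vector_Spaces.linear s1 s2 f \<Longrightarrow> f 0 = 0"
  unfolding linear_iff_module_hom by (rule module_hom.zero)

context poisson_algebra
begin

lemma brk_simps:
  "brk 0 x = 0" "brk x 0 = 0" "brk (x + y) z = brk x z + brk y z" "brk x (y + z) = brk x y + brk x z"
proof -
  have 1: "module_hom smul smul (brk x)" and 2: "module_hom smul smul (\<lambda>x. brk x y)" for x y
    using brk_bilinear by (auto simp: bilinear_map_def linear_iff_module_hom)
  show "brk 0 x = 0" "brk x 0 = 0" "brk (x + y) z = brk x z + brk y z"
    "brk x (y + z) = brk x y + brk x z"
    by (simp_all only: module_hom.zero[OF 1] module_hom.add[OF 1] module_hom.zero[OF 2]
        module_hom.add[OF 2])
qed

lemma mult_simps:
  "pmult 0 x = 0" "pmult x 0 = 0" "pmult (- x) y = - pmult x y" "pmult x (- y) = - pmult x y"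
proof -
  have 1: "module_hom smul smul (pmult x)" and 2: "module_hom smul smul (\<lambda>x. pmult x y)" for x y
    using mult_bilinear by (auto simp: bilinear_map_def linear_iff_module_hom)
  show "pmult 0 x = 0" "pmult x 0 = 0" "pmult (- x) y = - pmult x y" "pmult x (- y) = - pmult x y"
    by (simp_all only: module_hom.zero[OF 1] module_hom.neg[OF 1] module_hom.zero[OF 2]
        module_hom.neg[OF 2])
qed

lemma brk_anticommute: "brk x y = - brk y x"
proof -
  have "brk (x + y) (x + y) = 0" by (rule brk_alternating)
  then show ?thesis
    by (simp add: brk_simps brk_alternating[of x] brk_alternating[of y] eq_neg_iff_add_eq_0
        add.commute)
qed

lemma leibniz_left: "brk (pmult y z) x = pmult (brk y x) z + pmult y (brk z x)"
  using leibniz[of x y z] brk_anticommute[of "pmult y z" x] brk_anticommute[of y x]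
    brk_anticommute[of z x]
  by (simp add: mult_simps)

text \<open>
  The obstruction for \<open>G7\<close>, with \<open>p = d a\<close> and \<open>q = d b\<close>: the element \<open>{a, p}\<close> is annihilated by \<open>a\<close>,
  hence by the multiple \<open>b\<close> of \<open>a\<close>, but the Leibniz rule makes its product with \<open>b\<close> equal to \<open>{a, b}\<close>.
\<close>
lemma brk_eq_0_of_common_unit:
  assumes ap: "pmult a p = a" and bp: "pmult b p = b" and aq: "pmult a q = - b"
    and cp: "pmult (brk a b) p = 0"
  shows "brk a b = 0"
proof -
  define w where "w = brk a p"
  have aw: "pmult a w = 0"
    using leibniz[of a a p] ap by (simp add: brk_alternating mult_simps w_def)
  have "brk a b = pmult b w"
    using leibniz[of a b p] bp cp by (simp add: w_def)
  also have "pmult b w = - pmult q (pmult a w)"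
    using aq by (metis mult_assoc mult_commute mult_simps(3) minus_minus)
  finally show ?thesis using aw by (simp add: mult_simps)
qed

text \<open>The obstruction for \<open>G9\<close> and \<open>G10\<close>, with \<open>q = d b\<close>.\<close>
lemma brk_eq_0_of_annihilator:
  assumes aq: "pmult a q = 0" and cq: "pmult (brk a b) q = brk a b"
  shows "brk a b = 0"
proof -
  define w where "w = brk b q"
  have "brk a b = pmult a w"
    using leibniz_left[of a q b] brk_anticommute[of q b] aq cq
    by (simp add: w_def brk_simps mult_simps)
  then have "brk a b = pmult (pmult a q) w" using cq by (metis mult_assoc mult_commute)
  then show ?thesis using aq by (simp add: mult_simps)
qed

end

section \<open>The non-special structures\<close>

lemma heis_eb: "heis (eb 1) (eb 2) = eb 3"
  by (simp add: vec_eq_iff forall_3 axis_def)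

text \<open>
  An embedding is injective, so it is refuted once the image of \<open>eb 3 = heis (eb 1) (eb 2)\<close> is
  shown to vanish.
\<close>
lemma not_special_viaI:
  fixes circ :: "complex ^ 3 \<Rightarrow> complex ^ 3 \<Rightarrow> complex ^ 3"
  assumes kill: "\<And>(s :: complex \<Rightarrow> 'p::ab_group_add \<Rightarrow> 'p) m b d f.
      \<lbrakk>differential_poisson_algebra s m b d; Vector_Spaces.linear (*s) s f;
        \<And>x y. m (f x) (d (f y)) = f (circ x y); b (f (eb 1)) (f (eb 2)) = f (eb 3)\<rbrakk>
      \<Longrightarrow> f (eb 3) = 0"
  shows "\<not> special_via TYPE('p) (*s) circ heis"
proof
  assume "special_via TYPE('p) (*s) circ heis"
  then obtain s :: "complex \<Rightarrow> 'p \<Rightarrow> 'p" and m b d S f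
    where P: "differential_poisson_algebra s m b d"
      and f: "gd_iso_onto (*s) circ heis s (induced_circ m d) b S f"
    unfolding special_via_def by (elim exE conjE)
  then have lin: "Vector_Spaces.linear (*s) s f" and "inj f"
    and "\<And>x y. m (f x) (d (f y)) = f (circ x y)" "\<And>x y. b (f x) (f y) = f (heis x y)"
    unfolding gd_iso_onto_def induced_circ_def by (auto intro: bij_betw_imp_inj_on)
  then have "f (eb 3) = f 0"
    using kill[OF P lin] linear_0[OF lin] by (simp add: heis_eb)
  then show False
    using \<open>inj f\<close> by (simp add: inj_eq)
qed

lemma not_special_G7: "\<not> special_via TYPE('p::ab_group_add) (*s) G7 heis"
proof (rule not_special_viaI)
  fix s :: "complex \<Rightarrow> 'p \<Rightarrow> 'p" and m b d f
  assume P: "differential_poisson_algebra s m b d" and f: "Vector_Spaces.linear (*s) s f"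
    and hom: "\<And>x y. m (f x) (d (f y)) = f (G7 x y)" "b (f (eb 1)) (f (eb 2)) = f (eb 3)"
  interpret differential_poisson_algebra s m b d by (rule P)
  interpret f: Vector_Spaces.linear "(*s)" s f by (rule f)
  have G7: "G7 (eb 1) (eb 1) = eb 1" "G7 (eb 1) (eb 2) = - eb 2" "G7 (eb 2) (eb 1) = eb 2"
    "G7 (eb 3) (eb 1) = 0"
    by (simp_all add: G7_def product_of_table_3 vec_eq_iff forall_3 axis_def)
  have "b (f (eb 1)) (f (eb 2)) = 0"
    by (rule brk_eq_0_of_common_unit[where p = "d (f (eb 1))" and q = "d (f (eb 2))"])
      (simp_all add: hom G7 f.neg)
  then show "f (eb 3) = 0" by (simp add: hom)
qed

lemma not_special_if_annihilator:
  assumes "circ (eb 1) (eb 2) = 0" "circ (eb 3) (eb 2) = eb 3"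
  shows "\<not> special_via TYPE('p::ab_group_add) (*s) circ heis"
proof (rule not_special_viaI)
  fix s :: "complex \<Rightarrow> 'p \<Rightarrow> 'p" and m b d f
  assume P: "differential_poisson_algebra s m b d" and f: "Vector_Spaces.linear (*s) s f"
    and hom: "\<And>x y. m (f x) (d (f y)) = f (circ x y)" "b (f (eb 1)) (f (eb 2)) = f (eb 3)"
  interpret differential_poisson_algebra s m b d by (rule P)
  have "b (f (eb 1)) (f (eb 2)) = 0"
    by (rule brk_eq_0_of_annihilator[where q = "d (f (eb 2))"])
      (simp_all add: hom assms linear_0[OF f])
  then show "f (eb 3) = 0" by (simp add: hom)
qed

lemma not_special_G9_G10:
  "\<not> special_via TYPE('p::ab_group_add) (*s) G9 heis"
  "\<not> special_via TYPE('p::ab_group_add) (*s) G10 heis"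
  by (rule not_special_if_annihilator;
      simp add: G9_def G10_def product_of_table_3 vec_eq_iff forall_3 axis_def)+

section \<open>Coordinate triples inside power series\<close>

definition scale3 :: "('k \<Rightarrow> 'a \<Rightarrow> 'a) \<Rightarrow> 'k \<Rightarrow> 'a \<times> 'a \<times> 'a \<Rightarrow> 'a \<times> 'a \<times> 'a" where
  "scale3 s c = (\<lambda>(x, y, z). (s c x, s c y, s c z))"

definition fps_scale :: "('k \<Rightarrow> 'a \<Rightarrow> 'a) \<Rightarrow> 'k \<Rightarrow> 'a fps \<Rightarrow> 'a fps" where
  "fps_scale s c u = Abs_fps (\<lambda>n. s c (fps_nth u n))"

text \<open>
  The additive group of \<open>'a fps\<close> contains that of \<open>'a \<times> 'a \<times> 'a\<close> as a direct summand. So algebras with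
  few coordinates can be carried over to power series.
\<close>
definition fps_of_triple :: "'a \<times> 'a \<times> 'a \<Rightarrow> 'a::zero fps" where
  "fps_of_triple = (\<lambda>(x, y, z).
     Abs_fps (\<lambda>n. if n = 0 then x else if n = 1 then y else if n = 2 then z else 0))"

definition triple_of_fps :: "'a fps \<Rightarrow> 'a \<times> 'a \<times> 'a::zero" where
  "triple_of_fps u = (fps_nth u 0, fps_nth u 1, fps_nth u 2)"

lemma triple_of_fps_of_triple [simp]: "triple_of_fps (fps_of_triple x) = x"
  by (cases x) (simp add: triple_of_fps_def fps_of_triple_def)

lemma vector_space_scale3: "vector_space s \<Longrightarrow> vector_space (scale3 s)"
  by (auto simp: vector_space_def scale3_def)

lemma vector_space_fps_scale: "vector_space s \<Longrightarrow> vector_space (fps_scale s)"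
  by (auto simp: vector_space_def fps_scale_def fps_eq_iff)

lemma vector_space_scale_zero: "vector_space s \<Longrightarrow> s c 0 = 0"
  by (intro module.scale_zero_right) (simp add: module_iff_vector_space)

lemma linear_fps_of_triple:
  assumes "vector_space s"
  shows "Vector_Spaces.linear (scale3 s) (fps_scale s) fps_of_triple"
  unfolding Vector_Spaces.linear_iff using assms
  by (auto simp: vector_space_scale3 vector_space_fps_scale scale3_def fps_scale_def
      fps_of_triple_def fps_eq_iff vector_space_scale_zero)

lemma linear_triple_of_fps:
  assumes "vector_space s"
  shows "Vector_Spaces.linear (fps_scale s) (scale3 s) triple_of_fps"
  unfolding Vector_Spaces.linear_iff using assms
  by (auto simp: vector_space_scale3 vector_space_fps_scale scale3_def fps_scale_def
      triple_of_fps_def)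

section \<open>Specialness from a table of products\<close>

text \<open>
  A space that contains \<open>'q\<close> as a direct summand inherits the structure: all operations vanish on the
  complement, which is the kernel of the projection \<open>k\<close>.
\<close>
lemma differential_poisson_algebra_transport:
  assumes P: "differential_poisson_algebra s m b d"
    and j: "Vector_Spaces.linear s s' j" and k: "Vector_Spaces.linear s' s k"
    and kj: "\<And>x. k (j x) = x"
  shows "differential_poisson_algebra s' (\<lambda>x y. j (m (k x) (k y))) (\<lambda>x y. j (b (k x) (k y)))
           (\<lambda>x. j (d (k x)))"
proof -
  interpret P: differential_poisson_algebra s m b d by (rule P)
  have "vector_space s'" using j by (simp add: Vector_Spaces.linear_iff)
  then interpret V: vector_space s' .
  note lin = j k P.d_linear P.mult_bilinear P.brk_bilinear
  note lin = lin[unfolded bilinear_map_def Vector_Spaces.linear_iff]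
  have j0: "j 0 = 0" by (rule linear_0[OF j])
  have bl: "bilinear_map s' (\<lambda>x y. j (m (k x) (k y)))" "bilinear_map s' (\<lambda>x y. j (b (k x) (k y)))"
    and dl: "Vector_Spaces.linear s' s' (\<lambda>x. j (d (k x)))"
    unfolding bilinear_map_def Vector_Spaces.linear_iff using lin by simp_all
  then interpret D: Vector_Spaces.linear s' s' "\<lambda>x. j (d (k x))" by simp
  have j_add: "j x + j y = j (x + y)" for x y
    using j by (simp add: Vector_Spaces.linear_iff)
  show ?thesis
    by unfold_locales
      (simp_all add: bl j0 kj j_add P.brk_alternating P.jacobi P.mult_assoc P.leibniz P.d_mult P.d_brk
        P.mult_commute[of "k _" "k _"])
qed

lemma special_via_injective_hom:
  assumes P: "differential_poisson_algebra s m b d"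
    and lin: "Vector_Spaces.linear smul s (f :: _ \<Rightarrow> 'p)" and "inj f"
    and circ: "\<And>x y. f (circ x y) = m (f x) (d (f y))"
    and brk: "\<And>x y. f (brk x y) = b (f x) (f y)"
  shows "special_via TYPE('p::ab_group_add) smul circ (brk :: 'a::ab_group_add \<Rightarrow> 'a \<Rightarrow> 'a)"
proof -
  interpret P: differential_poisson_algebra s m b d by (rule P)
  interpret f: Vector_Spaces.linear smul s f by (rule lin)
  have "P.subspace (range f)"
    using f.subspace_image[OF f.vs1.subspace_UNIV] .
  then have "gd_subalgebra s (induced_circ m d) b (range f)"
    unfolding gd_subalgebra_def induced_circ_def using circ brk by (metis imageE rangeI)
  moreover have "gd_iso_onto smul circ brk s (induced_circ m d) b (range f) f"
    using assms by (simp add: gd_iso_onto_def induced_circ_def inj_on_imp_bij_betw)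
  ultimately show ?thesis using P unfolding special_via_def by (intro exI conjI)
qed

definition combination :: "(complex \<Rightarrow> 'q::ab_group_add \<Rightarrow> 'q) \<Rightarrow> (3 \<Rightarrow> 'q) \<Rightarrow> complex ^ 3 \<Rightarrow> 'q" where
  "combination s u x = (\<Sum>i\<in>UNIV. s (x $ i) (u i))"

lemma bilinear_sum:
  assumes "bilinear_map s m" "vector_space s"
  shows "m (\<Sum>i\<in>I. s (p i) (u i)) (\<Sum>j\<in>J. s (q j) (v j)) =
    (\<Sum>i\<in>I. \<Sum>j\<in>J. s (p i * q j) (m (u i) (v j)))"
proof -
  interpret vector_space s by fact
  have 1: "module_hom s s (m x)" and 2: "module_hom s s (\<lambda>x. m x y)" for x y
    using assms by (auto simp: bilinear_map_def linear_iff_module_hom)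
  show ?thesis
    by (subst sum.swap, simp add: mult.commute module_hom.sum[OF 1] module_hom.sum[OF 2]
        module_hom.scale[OF 1] module_hom.scale[OF 2] scale_sum_right)
qed

text \<open>
  Both sides of the homomorphism conditions are bilinear, so comparing them on basis vectors is
  enough.
\<close>
lemma special_via_table:
  fixes s :: "complex \<Rightarrow> 'q::ab_group_add \<Rightarrow> 'q" and s' :: "complex \<Rightarrow> 'p::ab_group_add \<Rightarrow> 'p"
  assumes P: "differential_poisson_algebra s m b d"
    and j: "Vector_Spaces.linear s s' j" and k: "Vector_Spaces.linear s' s k"
    and kj: "\<And>x. k (j x) = x"
    and indep: "\<And>x. combination s u x = 0 \<Longrightarrow> x = 0"
    and circ: "\<forall>i j. m (u i) (d (u j)) = combination s u (t (i, j))"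
    and brk: "\<forall>i j. b (u i) (u j) = combination s u (heis (eb i) (eb j))"
  shows "special_via TYPE('p) (*s) (product_of_table t) heis"
proof -
  let ?f = "combination s u"
  interpret P: differential_poisson_algebra s m b d by (rule P)
  have vs: "vector_space s" by unfold_locales
  have f: "Vector_Spaces.linear (*s) s ?f"
    unfolding Vector_Spaces.linear_iff
    by (simp add: vec.vector_space_axioms vs combination_def P.scale_left_distrib sum.distrib
        P.scale_sum_right)
  interpret f: Vector_Spaces.linear "(*s)" s ?f by (rule f)
  interpret d: Vector_Spaces.linear s s d by (rule P.d_linear)
  have table: "?f (product_of_table t' x y) =
      (\<Sum>i\<in>UNIV. \<Sum>j\<in>UNIV. s (x $ i * y $ j) (?f (t' (i, j))))"
    for t' x y
    by (simp add: product_of_table_def f.sum f.scale)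
  have "d (?f y) = (\<Sum>i\<in>UNIV. s (y $ i) (d (u i)))" for y
    by (simp add: combination_def d.sum d.scale)
  then have c: "?f (product_of_table t x y) = m (?f x) (d (?f y))" for x y
    by (simp only: table circ[rule_format, symmetric])
       (simp add: combination_def bilinear_sum[OF P.mult_bilinear vs])
  have h: "heis = product_of_table (\<lambda>(i, j). heis (eb i) (eb j))"
    by (intro ext) (simp add: vec_eq_iff forall_3 product_of_table_3 axis_def)
  have br: "?f (heis x y) = b (?f x) (?f y)" for x y
    by (subst h, simp only: table prod.case brk[rule_format, symmetric])
       (simp add: combination_def bilinear_sum[OF P.brk_bilinear vs])
  show ?thesis
  proof (rule special_via_injective_hom[OF differential_poisson_algebra_transport[OF P j k kj]])
    show "Vector_Spaces.linear (*s) s' (j \<circ> ?f)"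
      using f j by (rule Vector_Spaces.linear_compose)
    have "inj ?f" using indep unfolding f.inj_iff_eq_0 by blast
    moreover have "inj j" using kj by (rule inj_on_inverseI)
    ultimately show "inj (j \<circ> ?f)" by (rule inj_compose[rotated])
  qed (simp_all add: kj c br)
qed

lemma differential_poisson_algebraI:
  assumes "vector_space s"
    and "bilinear_map s m" "bilinear_map s b" "Vector_Spaces.linear s s d"
    and "\<And>x. b x x = 0"
    and "\<And>x y z. b x (b y z) + b y (b z x) + b z (b x y) = 0"
    and "\<And>x y. m x y = m y x"
    and "\<And>x y z. m (m x y) z = m x (m y z)"
    and "\<And>x y z. b x (m y z) = m (b x y) z + m y (b x z)"
    and "\<And>x y. d (m x y) = m (d x) y + m x (d y)"
    and "\<And>x y. d (b x y) = b (d x) y + b x (d y)"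
  shows "differential_poisson_algebra s m b d"
proof -
  interpret vector_space s by fact
  interpret Vector_Spaces.linear s s d by fact
  show ?thesis by unfold_locales fact+
qed

definition basis_images :: "'q \<Rightarrow> 'q \<Rightarrow> 'q \<Rightarrow> 3 \<Rightarrow> 'q" where
  "basis_images a b c = (\<lambda>i. if i = 1 then a else if i = 2 then b else c)"

lemma basis_images_apply:
  "basis_images a b c 1 = a" "basis_images a b c 2 = b" "basis_images a b c 3 = c"
  by (simp_all add: basis_images_def)

lemma combination_basis_images:
  "combination s (basis_images a b c) x = s (x $ 1) a + s (x $ 2) b + s (x $ 3) c"
  by (simp add: combination_def basis_images_def sum_3)

lemmas table_simps = combination_basis_images basis_images_apply scale3_def zero_prod_def
  forall_3 axis_def vec_eq_iff

section \<open>Extensions of the power series ring\<close>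

type_synonym series = "complex fps"
type_synonym series3 = "series \<times> series \<times> series"

lemma vector_space_fps_const: "vector_space (\<lambda>c. (*) (fps_const c) :: series \<Rightarrow> series)"
  by unfold_locales
    (simp_all add: distrib_left distrib_right mult.assoc flip: fps_const_add fps_const_mult)

abbreviation ext_scale :: "complex \<Rightarrow> series3 \<Rightarrow> series3" where
  "ext_scale \<equiv> scale3 (\<lambda>c. (*) (fps_const c))"

text \<open>
  A triple stands for \<open>f0 + f1 y + f2 z\<close>, with series \<open>f0, f1, f2\<close> in \<open>t\<close> and with \<open>y\<^sup>2 = \<kappa> z\<close>,
  \<open>y z = 0\<close>, \<open>z\<^sup>2 = 0\<close>. The bracket is the biderivation with \<open>{t, y} = z\<close> for which \<open>z\<close> is central,
  and the derivation has \<open>d t = \<theta>\<close> and \<open>d y = r y + s z\<close>.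
\<close>
fun ext_mult :: "series \<Rightarrow> series3 \<Rightarrow> series3 \<Rightarrow> series3" where
  "ext_mult \<kappa> (f0, f1, f2) (g0, g1, g2) =
     (f0 * g0, f0 * g1 + f1 * g0, f0 * g2 + f2 * g0 + \<kappa> * f1 * g1)"

fun ext_brk :: "series3 \<Rightarrow> series3 \<Rightarrow> series3" where
  "ext_brk (f0, f1, f2) (g0, g1, g2) = (0, 0, fps_deriv f0 * g1 - f1 * fps_deriv g0)"

text \<open>
  Since \<open>d t = \<theta>\<close> will be a constant, \<open>d {t, y} = {d t, y} + {t, d y}\<close> leaves no other choice than
  \<open>d z = r z\<close>.
\<close>
fun ext_deriv :: "series \<Rightarrow> series \<Rightarrow> series \<Rightarrow> series3 \<Rightarrow> series3" where
  "ext_deriv \<theta> r s (f0, f1, f2) =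
     (\<theta> * fps_deriv f0, \<theta> * fps_deriv f1 + r * f1, \<theta> * fps_deriv f2 + r * f2 + s * f1)"

text \<open>
  The condition \<open>\<kappa> r = 0\<close> comes from \<open>y\<^sup>2 = \<kappa> z\<close>: the left side has derivative \<open>2 \<kappa> r z\<close> and the right
  side, for constant \<open>\<kappa>\<close>, has derivative \<open>\<kappa> r z\<close>.
\<close>
lemma differential_poisson_ext:
  assumes const: "fps_deriv \<theta> = 0" "fps_deriv \<kappa> = 0" and \<kappa>r: "\<kappa> * r = 0"
  shows "differential_poisson_algebra ext_scale (ext_mult \<kappa>) ext_brk (ext_deriv \<theta> r s)"
proof (rule differential_poisson_algebraI)
  show vs: "vector_space ext_scale"
    by (intro vector_space_scale3 vector_space_fps_const)
  show "bilinear_map ext_scale (ext_mult \<kappa>)" "bilinear_map ext_scale ext_brk"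
    "Vector_Spaces.linear ext_scale ext_scale (ext_deriv \<theta> r s)"
    unfolding bilinear_map_def Vector_Spaces.linear_iff
    by (auto simp: vs scale3_def algebra_simps)
  have "\<kappa> * (r * f) = 0" "r * (\<kappa> * f) = 0" for f
    using \<kappa>r by auto
  note simps = this const zero_prod_def algebra_simps
  fix x y z :: series3
  obtain x0 x1 x2 where [simp]: "x = (x0, x1, x2)" by (rule prod_cases3)
  obtain y0 y1 y2 where [simp]: "y = (y0, y1, y2)" by (rule prod_cases3)
  obtain z0 z1 z2 where [simp]: "z = (z0, z1, z2)" by (rule prod_cases3)
  show "ext_brk x x = 0"
    by (simp add: simps)
  show "ext_brk x (ext_brk y z) + ext_brk y (ext_brk z x) + ext_brk z (ext_brk x y) = 0"
    by (simp add: simps)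
  show "ext_mult \<kappa> x y = ext_mult \<kappa> y x"
    by (simp add: simps)
  show "ext_mult \<kappa> (ext_mult \<kappa> x y) z = ext_mult \<kappa> x (ext_mult \<kappa> y z)"
    by (simp add: simps)
  show "ext_brk x (ext_mult \<kappa> y z) = ext_mult \<kappa> (ext_brk x y) z + ext_mult \<kappa> y (ext_brk x z)"
    by (simp add: simps)
  show "ext_deriv \<theta> r s (ext_mult \<kappa> x y) =
      ext_mult \<kappa> (ext_deriv \<theta> r s x) y + ext_mult \<kappa> x (ext_deriv \<theta> r s y)"
    using \<kappa>r by (auto simp: simps)
  show "ext_deriv \<theta> r s (ext_brk x y) =
      ext_brk (ext_deriv \<theta> r s x) y + ext_brk x (ext_deriv \<theta> r s y)"
    by (simp add: simps)
qed

lemma heis_special_ext: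
  fixes a b c :: series3
  defines "u \<equiv> basis_images a b c"
  assumes coeffs: "fps_deriv \<theta> = 0" "fps_deriv \<kappa> = 0" "\<kappa> * r = 0"
    and table: "\<And>x. combination ext_scale u x = 0 \<Longrightarrow> x = 0"
      "\<forall>i j. ext_mult \<kappa> (u i) (ext_deriv \<theta> r s (u j)) = combination ext_scale u (t (i, j))"
      "\<forall>i j. ext_brk (u i) (u j) = combination ext_scale u (heis (eb i) (eb j))"
  shows "heis_special (product_of_table t)"
  by (rule special_via_table[OF differential_poisson_ext[OF coeffs]
        linear_fps_of_triple[OF vector_space_fps_const]
        linear_triple_of_fps[OF vector_space_fps_const] triple_of_fps_of_triple table])

text \<open>
  The tables require the inverse and the logarithm of the series that plays the role of the
  variable. Both exist for \<open>1 + t\<close>, but not for \<open>t\<close>.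
\<close>
definition coord :: series where "coord = 1 + fps_X"

definition log_coord :: series where "log_coord = fps_ln 1"

lemma coord_nonzero: "coord \<noteq> 0"
  by (auto simp: coord_def dest: arg_cong[where f = "\<lambda>f. fps_nth f 0"])

lemma fps_deriv_coord: "fps_deriv coord = 1"
  by (simp add: coord_def)

lemma coord_inverse: "coord * inverse coord = 1"
  by (simp add: coord_def inverse_mult_eq_1')

lemma coord_inverse_cancel:
  "inverse coord * coord = 1" "inverse coord * (coord * f) = f" "coord * (inverse coord * f) = f"
proof -
  show c: "inverse coord * coord = 1" by (simp add: coord_inverse mult.commute)
  show "inverse coord * (coord * f) = f" "coord * (inverse coord * f) = f"
    by (simp_all add: c coord_inverse flip: mult.assoc)
qed

lemma fps_deriv_log_coord: "fps_deriv log_coord = inverse coord"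
  by (simp add: fps_ln_deriv log_coord_def coord_def)

lemma fps_const_minus_1: "fps_const (- 1 :: complex) = - 1"
  by (metis fps_const_1_eq_1 fps_const_neg)

lemmas ext_simps = table_simps coord_nonzero fps_deriv_coord coord_inverse coord_inverse_cancel
  fps_deriv_log_coord fps_const_minus_1

text \<open>
  In the next six proofs \<open>x\<close> is \<open>coord\<close>. The table of \<open>G1\<close> is met by \<open>a = x\<close>, \<open>b = y\<close>, \<open>c = z\<close>, with \<open>d\<close>
  vanishing on series so that \<open>a \<circ> a = b \<circ> a = c \<circ> a = 0\<close>; then \<open>a \<circ> b = b + \<alpha> c\<close> determines \<open>d y\<close>.
\<close>
lemma heis_special_G1: "heis_special (G1 \<alpha>)"
  unfolding G1_def
  by (rule heis_special_ext[where \<theta> = 0 and \<kappa> = 0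
        and r = "inverse coord" and s = "fps_const \<alpha> * inverse coord"
        and a = "(coord, 0, 0)" and b = "(0, 1, 0)" and c = "(0, 0, 1)"])
    (auto simp: ext_simps)

text \<open>
  Here \<open>b = x\<close> satisfies \<open>b \<circ> b = b\<close> for \<open>d = d/dt\<close>, and \<open>y\<^sup>2 = z\<close> makes \<open>a \<circ> a\<close> equal to
  \<open>c = x z\<close>. The sign in \<open>a = - x y + u z\<close> is
  that of \<open>{y, t} = - z\<close>. The condition \<open>b \<circ> a = a + \<alpha> c\<close> reads \<open>x u' = u + \<alpha> x\<close>, solved by
  \<open>u = \<alpha> x log x\<close>.
\<close>
lemma heis_special_G2: "heis_special (G2 \<alpha>)"
  unfolding G2_def
  by (rule heis_special_ext[where \<theta> = 1 and \<kappa> = 1 and r = 0 and s = 0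
        and a = "(0, - coord, fps_const \<alpha> * (coord * log_coord))"
        and b = "(coord, 0, 0)" and c = "(0, 0, coord)"])
    (auto simp: ext_simps distrib_left mult.left_commute)

lemma heis_special_G3: "heis_special (G3 \<alpha> \<beta>)"
  unfolding G3_def
  by (rule heis_special_ext[where \<theta> = 1 and \<kappa> = 0
        and r = "fps_const \<alpha> * inverse coord" and s = "fps_const \<beta> * inverse coord"
        and a = "(coord, 0, 0)" and b = "(0, 1, 0)" and c = "(0, 0, 1)"])
    (auto simp: ext_simps mult.left_commute)

text \<open>
  With \<open>b = y\<close>, \<open>c = z\<close>, \<open>d y = (\<alpha> / x) z\<close> and \<open>a = x + u y + v z\<close>, the condition \<open>a \<circ> a = a + b\<close>
  reads \<open>x u' = 1\<close> and \<open>x v' = - \<alpha> u\<close>, so \<open>u = log x\<close> and \<open>v = - (\<alpha> / 2) (log x)\<^sup>2\<close>.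
\<close>
lemma heis_special_G4: "heis_special (G4 \<alpha>)"
proof -
  obtain \<gamma> where \<alpha>: "\<alpha> = \<gamma> * 2" using that[of "\<alpha> / 2"] by simp
  have double: "fps_const (\<gamma> * 2) = fps_const \<gamma> * 2"
    by (simp add: numeral_fps_const)
  show ?thesis
    unfolding G4_def
    by (rule heis_special_ext[where \<theta> = 1 and \<kappa> = 0
          and r = 0 and s = "fps_const \<alpha> * inverse coord"
          and a = "(coord, log_coord, - (fps_const \<gamma> * (log_coord * log_coord)))"
          and b = "(0, 1, 0)" and c = "(0, 0, 1)"],
        auto simp: ext_simps algebra_simps \<alpha>, metis double)
qed

text \<open>For \<open>a = x + v z\<close> the condition \<open>a \<circ> a = a + c\<close> reads \<open>x v' = 1\<close>.\<close>
lemma heis_special_G5: "heis_special G5"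
  unfolding G5_def
  by (rule heis_special_ext[where \<theta> = 1 and \<kappa> = 0 and r = 0 and s = 0
        and a = "(coord, 0, log_coord)" and b = "(0, 1, 0)" and c = "(0, 0, 1)"])
    (auto simp: ext_simps)

lemma heis_special_G12: "heis_special (G12 \<alpha>)"
  unfolding G12_def
  by (rule heis_special_ext[where \<theta> = 1 and \<kappa> = 0
        and r = 0 and s = "fps_const \<alpha> * inverse coord"
        and a = "(coord, 0, 0)" and b = "(0, 1, 0)" and c = "(0, 0, 1)"])
    (auto simp: ext_simps mult.left_commute)

section \<open>Nilpotent algebras\<close>

type_synonym complex3 = "complex \<times> complex \<times> complex"
type_synonym complex9 = "complex3 \<times> complex3 \<times> complex3"

abbreviation scale9 :: "complex \<Rightarrow> complex9 \<Rightarrow> complex9" where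
  "scale9 \<equiv> scale3 (scale3 (*))"

lemma vector_space_times: "vector_space ((*) :: complex \<Rightarrow> complex \<Rightarrow> complex)"
  by unfold_locales (simp_all add: algebra_simps)

lemma vector_space_scale9: "vector_space scale9"
  by (intro vector_space_scale3 vector_space_times)

fun map3 :: "('a \<Rightarrow> 'b) \<Rightarrow> 'a \<times> 'a \<times> 'a \<Rightarrow> 'b \<times> 'b \<times> 'b" where
  "map3 h (x, y, z) = (h x, h y, h z)"

lemma linear_map3:
  assumes "Vector_Spaces.linear s s' h"
  shows "Vector_Spaces.linear (scale3 s) (scale3 s') (map3 h)"
  using assms unfolding Vector_Spaces.linear_iff
  by (auto simp: vector_space_scale3 scale3_def)

lemma heis_special_complex9:
  assumes P: "differential_poisson_algebra scale9 m b d"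
    and table: "\<And>x. combination scale9 u x = 0 \<Longrightarrow> x = 0"
      "\<forall>i j. m (u i) (d (u j)) = combination scale9 u (t (i, j))"
      "\<forall>i j. b (u i) (u j) = combination scale9 u (heis (eb i) (eb j))"
  shows "heis_special (product_of_table t)"
proof (rule special_via_table[OF P _ _ _ table])
  note vs = vector_space_times vector_space_fps_scale[OF vector_space_times]
  show "Vector_Spaces.linear scale9 (fps_scale (fps_scale (*)))
      (fps_of_triple \<circ> map3 fps_of_triple)"
    by (rule Vector_Spaces.linear_compose[OF linear_map3[OF linear_fps_of_triple[OF vs(1)]]
          linear_fps_of_triple[OF vs(2)]])
  show "Vector_Spaces.linear (fps_scale (fps_scale (*))) scale9
      (map3 triple_of_fps \<circ> triple_of_fps)"
    by (rule Vector_Spaces.linear_compose[OF linear_triple_of_fps[OF vs(2)]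
          linear_map3[OF linear_triple_of_fps[OF vs(1)]]])
  show "(map3 triple_of_fps \<circ> triple_of_fps) ((fps_of_triple \<circ> map3 fps_of_triple) x) = x" for x
    by (cases x) simp
qed

lemmas complex9_simps = bilinear_map_def Vector_Spaces.linear_iff vector_space_scale9 scale3_def
  zero_prod_def

text \<open>
  The next algebra serves a product \<open>x \<circ> y = m(x, y) e3\<close> with a bilinear form \<open>m\<close> on the span of
  \<open>e1, e2\<close>. It consists of three copies of the Heisenberg algebra: the original one with coordinates
  \<open>(a, b, c)\<close>, formal derivatives of \<open>e1, e2\<close> with coordinates \<open>p, q\<close>, and a formal primitive of \<open>e3\<close>
  with coordinate \<open>e\<close>. The product of \<open>x\<close> with the formal derivative of \<open>y\<close> must be \<open>m(x, y) e3\<close>. So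
  the derivative of \<open>x y\<close> is \<open>(m(x, y) + m(y, x)) e3\<close>, and \<open>x y\<close> can be taken as this multiple of
  the primitive of \<open>e3\<close>.
\<close>
fun two_step_mult ::
  "complex \<Rightarrow> complex \<Rightarrow> complex \<Rightarrow> complex \<Rightarrow> complex9 \<Rightarrow> complex9 \<Rightarrow> complex9" where
  "two_step_mult m11 m12 m21 m22 ((a, b, _), (p, q, _), _) ((a', b', _), (p', q', _), _) =
     ((0, 0, m11 * (a * p' + a' * p) + m12 * (a * q' + a' * q) +
             m21 * (b * p' + b' * p) + m22 * (b * q' + b' * q)),
      (0, 0, 0),
      (0, 0, 2 * m11 * (a * a') + (m12 + m21) * (a * b' + a' * b) + 2 * m22 * (b * b')))"

fun two_step_brk :: "complex9 \<Rightarrow> complex9 \<Rightarrow> complex9" where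
  "two_step_brk ((a, b, c), _, _) ((a', b', c'), _, _) =
     ((0, 0, a * b' - b * a'), (0, 0, 0), (0, 0, 0))"

fun two_step_deriv :: "complex9 \<Rightarrow> complex9" where
  "two_step_deriv ((a, b, c), _, (_, _, e)) = ((0, 0, e), (a, b, 0), (0, 0, 0))"

lemma differential_poisson_two_step:
  "differential_poisson_algebra scale9 (two_step_mult m11 m12 m21 m22) two_step_brk two_step_deriv"
  by (rule differential_poisson_algebraI[OF vector_space_scale9])
    (auto simp: complex9_simps algebra_simps)

lemma heis_special_two_step:
  assumes "\<forall>i j. t (i, j) = (if i = 3 \<or> j = 3 then 0 else
     (if i = 1 then if j = 1 then m11 else m12 else if j = 1 then m21 else m22) *s eb 3)"
  shows "heis_special (product_of_table t)"
  by (rule heis_special_complex9[OF differential_poisson_two_step[of m11 m12 m21 m22],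
        where u = "basis_images ((1, 0, 0), (0, 0, 0), (0, 0, 0)) ((0, 1, 0), (0, 0, 0), (0, 0, 0))
          ((0, 0, 1), (0, 0, 0), (0, 0, 0))"])
    (auto simp: assms table_simps)

lemma heis_special_G6: "heis_special (G6 \<alpha>)"
  unfolding G6_def by (rule heis_special_two_step[of _ 0 "- \<alpha>" \<alpha> 0]) (auto simp: forall_3)

lemma heis_special_G11: "heis_special (G11 \<alpha> \<beta>)"
  unfolding G11_def by (rule heis_special_two_step[of _ \<alpha> \<beta> 0 1]) (auto simp: forall_3)

text \<open>
  The algebra for \<open>G8\<close> is graded by the degree in \<open>b\<close>, one triple of coordinates for each of the
  degrees one, two and three.

  \<^item> Degree one: \<open>b\<close>, \<open>q = d b\<close>, \<open>r = d q\<close>, with \<open>d r = 0\<close>.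
  \<^item> Degree two: \<open>h = b\<^sup>2\<close>, \<open>a = b q\<close>, \<open>s = {q, b}\<close>, with \<open>d s = 0\<close>. The bracket \<open>{a, b} = b {q, b}\<close>
    shows that \<open>b s = c\<close> is needed. The conditions \<open>a q = \<alpha> c\<close> and \<open>b (d a) = \<beta> c\<close>, where
    \<open>d a = q\<^sup>2 + b r\<close>, are therefore met by \<open>q\<^sup>2 = \<alpha> s\<close> and \<open>b r = (\<beta> - \<alpha>) s\<close>.
  \<^item> Degree three: \<open>c\<close> with \<open>d c = 0\<close>, and formal primitives \<open>e\<close> of \<open>c\<close> and \<open>g\<close> of \<open>e\<close>. They are
    needed because \<open>b a\<close> has derivative \<open>(\<alpha> + \<beta>) c\<close> and \<open>b h\<close> has derivative \<open>3 b a\<close>. The bracket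
    \<open>{q, h} = 2 b {q, b} = 2 c\<close> is forced by the Leibniz rule.
\<close>
fun G8_mult :: "complex \<Rightarrow> complex \<Rightarrow> complex9 \<Rightarrow> complex9 \<Rightarrow> complex9" where
  "G8_mult \<alpha> \<beta> ((b, q, r), (h, a, s), _) ((b', q', r'), (h', a', s'), _) =
     ((0, 0, 0),
      (b * b', b * q' + b' * q, \<alpha> * (q * q') + (\<beta> - \<alpha>) * (b * r' + b' * r)),
      (3 * (\<alpha> + \<beta>) * (b * h' + b' * h),
       (\<alpha> + \<beta>) * (b * a' + b' * a + q * h' + q' * h),
       b * s' + b' * s + \<alpha> * (q * a' + q' * a) + (\<beta> - \<alpha>) * (r * h' + r' * h)))"

fun G8_brk :: "complex9 \<Rightarrow> complex9 \<Rightarrow> complex9" where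
  "G8_brk ((b, q, r), (h, a, s), _) ((b', q', r'), (h', a', s'), _) =
     ((0, 0, 0), (0, 0, q * b' - b * q'), (0, 0, a * b' - b * a' + 2 * (q * h' - h * q')))"

fun G8_deriv :: "complex \<Rightarrow> complex9 \<Rightarrow> complex9" where
  "G8_deriv \<beta> ((b, q, r), (h, a, s), (g, e, c)) = ((0, b, q), (0, 2 * h, \<beta> * a), (0, g, e))"

lemma differential_poisson_G8:
  "differential_poisson_algebra scale9 (G8_mult \<alpha> \<beta>) G8_brk (G8_deriv \<beta>)"
  by (rule differential_poisson_algebraI[OF vector_space_scale9])
    (auto simp: complex9_simps algebra_simps)

lemma heis_special_G8: "heis_special (G8 \<alpha> \<beta>)"
  unfolding G8_def
  by (rule heis_special_complex9[OF differential_poisson_G8[of \<alpha> \<beta>],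
        where u = "basis_images ((0, 0, 0), (0, 1, 0), (0, 0, 0)) ((1, 0, 0), (0, 0, 0), (0, 0, 0))
          ((0, 0, 0), (0, 0, 0), (0, 0, 1))"])
    (auto simp: table_simps)

section \<open>The classification\<close>

theorem proposition7p10:
  shows
   "((\<forall>\<alpha>. heis_gd (G1 \<alpha>)) \<and>
     (\<forall>\<alpha>. heis_gd (G2 \<alpha>)) \<and>
     (\<forall>\<alpha> \<beta>. \<alpha> \<noteq> 0 \<longrightarrow> heis_gd (G3 \<alpha> \<beta>)) \<and>
     (\<forall>\<alpha>. heis_gd (G4 \<alpha>)) \<and>
     heis_gd G5 \<and>
     (\<forall>\<alpha>. heis_gd (G6 \<alpha>)) \<and>
     heis_gd G7 \<and>
     (\<forall>\<alpha> \<beta>. heis_gd (G8 \<alpha> \<beta>)) \<and>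
     heis_gd G9 \<and>
     heis_gd G10 \<and>
     (\<forall>\<alpha> \<beta>. heis_gd (G11 \<alpha> \<beta>)) \<and>
     (\<forall>\<alpha>. heis_gd (G12 \<alpha>))) \<and>
    (\<not> special_via TYPE('p::ab_group_add) (*s) G7 heis \<and>
     \<not> special_via TYPE('p::ab_group_add) (*s) G9 heis \<and>
     \<not> special_via TYPE('p::ab_group_add) (*s) G10 heis) \<and>
    ((\<forall>\<alpha>. heis_special (G1 \<alpha>)) \<and>
     (\<forall>\<alpha>. heis_special (G2 \<alpha>)) \<and>
     (\<forall>\<alpha> \<beta>. \<alpha> \<noteq> 0 \<longrightarrow> heis_special (G3 \<alpha> \<beta>)) \<and>
     (\<forall>\<alpha>. heis_special (G4 \<alpha>)) \<and>
     heis_special G5 \<and>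
     (\<forall>\<alpha>. heis_special (G6 \<alpha>)) \<and>
     (\<forall>\<alpha> \<beta>. heis_special (G8 \<alpha> \<beta>)) \<and>
     (\<forall>\<alpha> \<beta>. heis_special (G11 \<alpha> \<beta>)) \<and>
     (\<forall>\<alpha>. heis_special (G12 \<alpha>)))"
  using heis_gd_G1_to_G12 not_special_G7 not_special_G9_G10 heis_special_G1 heis_special_G2
    heis_special_G3 heis_special_G4 heis_special_G5 heis_special_G6 heis_special_G8
    heis_special_G11 heis_special_G12
  by (intro conjI allI impI)

end
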